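(* Let $s\geq 2$ and let $n\in\{2s+1,2s+2\}$ with $\gcd(n,s)=1$. The circulant graph $\mathrm{circ}(n;\pm1,\pm s)$ is not $3$-spanning cyclable.
   Context: $\mathrm{circ}(n;\pm1,\pm s)$ is the Cayley graph on $\mathbb{Z}/n\mathbb{Z}$ with connection set $\{\pm1,\pm s\}$: vertices $u_0,\dots,u_{n-1}$ (indices mod $n$), with $u_i$ adjacent to $u_{i\pm1}$ and $u_{i\pm s}$. A 2-factor of a graph is a spanning subgraph in which every vertex has valency 2; it separates a set $A$ of $k$ vertices if it consists of exactly $k$ cycles and $A$ meets the vertex set of each cycle in exactly one vertex. A graph $X$ is $k$-spanning cyclable if for every $A\subseteq V(X)$ with $|A|=k$ there is a 2-factor of $X$ separating $A$. *)

theory Defs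
  imports "HOL-Algebra.Elementary_Groups"
begin

text \<open>Graphs are undirected; an edge is the set of its two ends.\<close>

record 'a ugraph =
  uverts :: "'a set"
  uedges :: "'a set set"

definition simple_graph :: "'a ugraph \<Rightarrow> bool" where
  "simple_graph G \<longleftrightarrow> (\<forall>e \<in> uedges G. e \<subseteq> uverts G \<and> card e = 2)"

definition is_subgraph :: "'a ugraph \<Rightarrow> 'a ugraph \<Rightarrow> bool" where
  "is_subgraph H G \<longleftrightarrow> simple_graph H \<and> uverts H \<subseteq> uverts G \<and> uedges H \<subseteq> uedges G"

definition valency :: "'a ugraph \<Rightarrow> 'a \<Rightarrow> nat" where
  "valency G v = card {w \<in> uverts G. {v, w} \<in> uedges G}"

definition two_factor :: "'a ugraph \<Rightarrow> 'a ugraph \<Rightarrow> bool" where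
  "two_factor F G \<longleftrightarrow>
     is_subgraph F G \<and> uverts F = uverts G \<and> (\<forall>v \<in> uverts F. valency F v = 2)"

text \<open>A cycle, regarded as a graph: distinct vertices in cyclic order, at least three of them,
  joined consecutively.\<close>

definition is_cycle :: "'a ugraph \<Rightarrow> bool" where
  "is_cycle C \<longleftrightarrow>
     (\<exists>vs. distinct vs \<and> 3 \<le> length vs \<and> uverts C = set vs \<and>
           uedges C = {{vs ! i, vs ! (Suc i mod length vs)} |i. i < length vs})"

text \<open>The graph \<open>F\<close> consists of exactly the cycles in the finite family \<open>CS\<close>, i.e. it is
  their vertex-disjoint union.\<close>

definition consists_of_cycles :: "'a ugraph \<Rightarrow> 'a ugraph set \<Rightarrow> bool" where
  "consists_of_cycles F CS \<longleftrightarrow>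
     finite CS \<and> (\<forall>C \<in> CS. is_cycle C) \<and>
     (\<forall>C \<in> CS. \<forall>D \<in> CS. C \<noteq> D \<longrightarrow> uverts C \<inter> uverts D = {}) \<and>
     uverts F = (\<Union>C \<in> CS. uverts C) \<and> uedges F = (\<Union>C \<in> CS. uedges C)"

definition separates :: "'a ugraph \<Rightarrow> 'a set \<Rightarrow> bool" where
  "separates F A \<longleftrightarrow>
     (\<exists>CS. consists_of_cycles F CS \<and> card CS = card A \<and>
           (\<forall>C \<in> CS. \<exists>!a. a \<in> A \<and> a \<in> uverts C))"

definition spanning_cyclable :: "nat \<Rightarrow> 'a ugraph \<Rightarrow> bool" where
  "spanning_cyclable k G \<longleftrightarrow>
     (\<forall>A. A \<subseteq> uverts G \<and> finite A \<and> card A = k \<longrightarrow>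
          (\<exists>F. two_factor F G \<and> separates F A))"

text \<open>The connection set is meant to be inverse-closed and not to contain the identity.\<close>

definition cayley_graph :: "('a, 'b) monoid_scheme \<Rightarrow> 'a set \<Rightarrow> 'a ugraph" where
  "cayley_graph G S =
     \<lparr>uverts = carrier G, uedges = {{g, g \<otimes>\<^bsub>G\<^esub> t} |g t. g \<in> carrier G \<and> t \<in> S}\<rparr>"

text \<open>For \<open>n > 0\<close>, the carrier of \<open>integer_mod_group n\<close> is the set of
  representatives \<open>0, \<dots>, n - 1\<close>, so the connection set is reduced modulo \<open>n\<close>.\<close>

definition circ :: "nat \<Rightarrow> nat \<Rightarrow> int ugraph" where
  "circ n s =
     cayley_graph (integer_mod_group n) ((\<lambda>t. t mod int n) ` {1, -1, int s, - int s})"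

lemma uverts_circ: "n > 0 \<Longrightarrow> uverts (circ n s) = {0..<int n}"
  by (simp add: circ_def cayley_graph_def carrier_integer_mod_group)

lemma uedges_circ:
  assumes "n > 0"
  shows "uedges (circ n s) =
    {{g, (g + t) mod int n} |g t. g \<in> {0..<int n} \<and> t \<in> {1, -1, int s, - int s}}"
proof -
  define T where "T = {1, -1, int s, - int s}"
  have eq: "{f g t |g t. g \<in> A \<and> t \<in> S} = (\<Union>g \<in> A. f g ` S)"
    for f :: "int \<Rightarrow> int \<Rightarrow> int set" and A S
    by blast
  have "uedges (circ n s) =
      (\<Union>g \<in> {0..<int n}. (\<lambda>t. {g, (g + t) mod int n}) ` (\<lambda>t. t mod int n) ` T)"
    using assms
    by (simp only: circ_def cayley_graph_def ugraph.simps eq carrier_integer_mod_group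
        mult_integer_mod_group T_def) simp
  also have "\<dots> = (\<Union>g \<in> {0..<int n}. (\<lambda>t. {g, (g + t) mod int n}) ` T)"
    by (simp only: image_image mod_add_right_eq)
  finally show ?thesis
    by (simp only: eq T_def)
qed

lemma adjacent_circ_iff:
  assumes "n > 0" "i \<in> {0..<int n}" "j \<in> {0..<int n}"
  shows "{i, j} \<in> uedges (circ n s) \<longleftrightarrow>
    j \<in> {(i + 1) mod int n, (i - 1) mod int n, (i + int s) mod int n, (i - int s) mod int n}"
  (is "?L \<longleftrightarrow> ?R")
proof -
  define T where "T = {1, -1, int s, - int s}"
  have L: "?L \<longleftrightarrow> (\<exists>g t. {i, j} = {g, (g + t) mod int n} \<and> 0 \<le> g \<and> g < int n \<and> t \<in> T)"
    unfolding uedges_circ[OF assms(1)] T_def[symmetric] mem_Collect_eq atLeastLessThan_iff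
    by (simp only: conj_assoc)
  have R: "?R \<longleftrightarrow> (\<exists>t \<in> T. j = (i + t) mod int n)"
    unfolding T_def by simp
  have neg: "- t \<in> T" if "t \<in> T" for t
    using that unfolding T_def by auto
  have "?L \<longleftrightarrow> (\<exists>t \<in> T. j = (i + t) mod int n)"
  proof
    assume ?L
    then obtain g t where gt: "{i, j} = {g, (g + t) mod int n}" "t \<in> T"
      unfolding L by auto
    then consider "i = g" "j = (g + t) mod int n" | "j = g" "i = (g + t) mod int n"
      unfolding doubleton_eq_iff by blast
    then show "\<exists>t \<in> T. j = (i + t) mod int n"
    proof cases
      case 1
      then show ?thesis using gt(2) by blast
    next
      case 2
      have "(i + - t) mod int n = (g + t + - t) mod int n"
        unfolding 2(2) by (rule mod_add_left_eq)
      also have "\<dots> = j mod int n"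
        using 2(1) by simp
      also have "\<dots> = j"
        using assms(3) by simp
      finally show ?thesis
        using neg[OF gt(2)] by (intro bexI[of _ "- t"]) (rule sym)
    qed
  next
    assume "\<exists>t \<in> T. j = (i + t) mod int n"
    then obtain t where "t \<in> T" "{i, j} = {i, (i + t) mod int n}"
      by blast
    then show ?L
      unfolding L using assms(2) atLeastLessThan_iff by blast
  qed
  then show ?thesis
    by (simp only: R)
qed

lemma simple_graph_circ:
  assumes "2 \<le> s" "s < n"
  shows "simple_graph (circ n s)"
proof -
  have "n > 0"
    using assms by simp
  have neq: "(g + t) mod int n \<noteq> g"
    if "g \<in> {0..<int n}" "t \<in> {1, -1, int s, - int s}" for g t
  proof
    assume "(g + t) mod int n = g"
    then have "(g + t) mod int n = g mod int n"
      using that(1) by simp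
    then have "int n dvd t"
      by (simp add: mod_eq_dvd_iff)
    moreover have "t \<noteq> 0" "\<bar>t\<bar> < int n"
      using that(2) assms by auto
    ultimately show False
      using dvd_imp_le_int[of t "int n"] by linarith
  qed
  have "e \<subseteq> {0..<int n} \<and> card e = 2" if e: "e \<in> uedges (circ n s)" for e
  proof -
    from e obtain g t where gt: "e = {g, (g + t) mod int n}" "g \<in> {0..<int n}"
      "t \<in> {1, -1, int s, - int s}"
      unfolding uedges_circ[OF \<open>n > 0\<close>] by blast
    then have "(g + t) mod int n \<noteq> g"
      using neq by blast
    then show ?thesis
      using gt(1,2) \<open>n > 0\<close> by simp
  qed
  then show ?thesis
    by (simp add: simple_graph_def uverts_circ[OF \<open>n > 0\<close>])
qed

end

(* In a 2-factor separating A, the two neighbours of each vertex of A lie on its own cycle. So they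
   lie outside A, and distinct vertices of A have no common neighbour in the 2-factor. Hence every
   subset B of A has at least 2|B| neighbours outside A. For n = 2s + 1 this fails for A = {0, s, s + 1}
   and B = {0, s}, and for n = 2s + 2 it fails for A = {0, 1, s + 1} and B = {0, s + 1}. *)

theory Submission
  imports Defs
begin

lemma is_cycle_edge_subset:
  assumes "is_cycle C" "e \<in> uedges C"
  shows "e \<subseteq> uverts C"
proof -
  obtain vs where vs: "3 \<le> length vs" "uverts C = set vs"
    "uedges C = {{vs ! i, vs ! (Suc i mod length vs)} |i. i < length vs}"
    using assms(1) unfolding is_cycle_def by blast
  then obtain i where i: "i < length vs" "e = {vs ! i, vs ! (Suc i mod length vs)}"
    using assms(2) by blast
  have "Suc i mod length vs < length vs"
    using vs(1) by (intro mod_less_divisor) linarith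
  then show ?thesis
    using vs(2) i by simp
qed

text \<open>A necessary condition of Hall type: its conclusion no longer mentions \<open>F\<close>,
  so its failure for a single \<open>B\<close> rules out every 2-factor at once.\<close>

lemma separating_two_factor_card_le:
  assumes F: "two_factor F G" and sep: "separates F A"
    and A: "A \<subseteq> uverts G" and B: "B \<subseteq> A" "finite B"
    and fin: "finite (uverts G)"
  shows "2 * card B \<le> card {w \<in> uverts G - A. \<exists>b \<in> B. {b, w} \<in> uedges G}"
proof -
  define N where "N = (\<lambda>a. {w \<in> uverts F. {a, w} \<in> uedges F})"
  obtain CS where CS: "\<forall>C \<in> CS. is_cycle C"
      "\<forall>C \<in> CS. \<forall>D \<in> CS. C \<noteq> D \<longrightarrow> uverts C \<inter> uverts D = {}"
      "uedges F = (\<Union>C \<in> CS. uedges C)"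
    and uniq: "\<forall>C \<in> CS. \<exists>!a. a \<in> A \<and> a \<in> uverts C"
    using sep unfolding separates_def consists_of_cycles_def by blast
  have sub: "uverts F = uverts G" "uedges F \<subseteq> uedges G"
    and simple: "simple_graph F" and val: "\<forall>v \<in> uverts G. card (N v) = 2"
    using F unfolding two_factor_def is_subgraph_def valency_def N_def by auto
  \<comment> \<open>Each edge of \<open>F\<close> belongs to one of the cycles, which then contains
    both ends.\<close>
  have cyc: "\<exists>C \<in> CS. a \<in> uverts C \<and> w \<in> uverts C" if "w \<in> N a" for a w
    using that CS(1,3) is_cycle_edge_subset[of _ "{a, w}"] unfolding N_def by fastforce
  \<comment> \<open>A cycle meets \<open>A\<close> only once, so a neighbour of \<open>a\<close> in
    \<open>A\<close> would be \<open>a\<close> itself, giving a loop.\<close>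
  have outside: "w \<notin> A" if "a \<in> A" "w \<in> N a" for a w
  proof
    assume "w \<in> A"
    then have "w = a"
      using cyc[OF that(2)] uniq that(1) by blast
    then have "card {a, a} = 2"
      using that(2) simple unfolding N_def simple_graph_def by blast
    then show False
      by simp
  qed
  \<comment> \<open>A common neighbour lies on only one cycle, which would then contain both
    \<open>a\<close> and \<open>b\<close>.\<close>
  have disj: "N a \<inter> N b = {}" if "a \<in> A" "b \<in> A" "a \<noteq> b" for a b
  proof (rule ccontr)
    assume "N a \<inter> N b \<noteq> {}"
    then obtain w where w: "w \<in> N a" "w \<in> N b"
      by blast
    obtain C D where "C \<in> CS" "a \<in> uverts C" "w \<in> uverts C"
      "D \<in> CS" "b \<in> uverts D" "w \<in> uverts D"
      using cyc[OF w(1)] cyc[OF w(2)] by blast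
    moreover from this have "C = D"
      using CS(2) by blast
    ultimately show False
      using uniq that by blast
  qed
  have finN: "finite (N a)" for a
    using fin sub(1) unfolding N_def by simp
  have "card (\<Union>b \<in> B. N b) = (\<Sum>b \<in> B. card (N b))"
    using B disj finN by (intro card_UN_disjoint) blast+
  also have "\<dots> = (\<Sum>b \<in> B. 2)"
    using A B val by (intro sum.cong) auto
  finally have "2 * card B = card (\<Union>b \<in> B. N b)"
    by simp
  also have "\<dots> \<le> card {w \<in> uverts G - A. \<exists>b \<in> B. {b, w} \<in> uedges G}"
  proof (rule card_mono)
    show "(\<Union>b \<in> B. N b) \<subseteq> {w \<in> uverts G - A. \<exists>b \<in> B. {b, w} \<in> uedges G}"
      using B(1) sub outside unfolding N_def by blast
  qed (use fin in simp)
  finally show ?thesis .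
qed

text \<open>The contrapositive, with a superset \<open>W\<close> of the outer neighbours, so that
  only an upper bound on them has to be checked.\<close>

lemma not_spanning_cyclable_if_few_neighbours:
  assumes "finite (uverts G)" "A \<subseteq> uverts G" "card A = k" "B \<subseteq> A"
    and "{w \<in> uverts G - A. \<exists>b \<in> B. {b, w} \<in> uedges G} \<subseteq> W"
    and "finite W" "card W < 2 * card B"
  shows "\<not> spanning_cyclable k G"
proof
  assume sc: "spanning_cyclable k G"
  have "finite A"
    using assms(1,2) by (rule rev_finite_subset)
  then obtain F where "two_factor F G" "separates F A"
    using sc assms(2,3) unfolding spanning_cyclable_def by blast
  then have "2 * card B \<le> card {w \<in> uverts G - A. \<exists>b \<in> B. {b, w} \<in> uedges G}"
    using assms(1,2,4) finite_subset[OF assms(4) \<open>finite A\<close>]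
    by (intro separating_two_factor_card_le)
  also have "\<dots> \<le> card W"
    using assms(5,6) by (intro card_mono)
  finally show False
    using assms(7) by simp
qed

theorem theorem5p3:
  fixes n s :: nat
  assumes "s \<ge> 2" and "n \<in> {2 * s + 1, 2 * s + 2}" and "gcd n s = 1"
  shows "\<not> spanning_cyclable 3 (circ n s)"
proof -
  define m where "m = int s"
  have m: "m \<ge> 2"
    using assms(1) by (simp add: m_def)
  have n: "n > 0"
    using assms(2) by auto
  have verts: "uverts (circ n s) = {0..<int n}"
    using n by (rule uverts_circ)
  \<comment> \<open>Brings the neighbours \<open>-1\<close> and \<open>-m\<close> of the vertex
    \<open>0\<close> into the range of representatives.\<close>
  have neg: "(- t) mod int n = int n - t" if "0 < t" "t < int n" for t
    using that by (simp add: zmod_zminus1_eq_if)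
  have adj: "w \<in> {(b + 1) mod int n, (b - 1) mod int n, (b + m) mod int n, (b - m) mod int n}"
    if "{b, w} \<in> uedges (circ n s)" "b \<in> {0..<int n}" "w \<in> {0..<int n}" for b w
    using that adjacent_circ_iff[OF n, of b w s] by (simp add: m_def)
  consider "int n = 2 * m + 1" | "int n = 2 * m + 2"
    using assms(2) by (auto simp: m_def)
  then show ?thesis
  proof cases
    case 1
    \<comment> \<open>Since \<open>-m\<close> is \<open>m + 1\<close> modulo \<open>n\<close>, the
      set \<open>A\<close> is a triangle. Outside it, \<open>0\<close> has the neighbours
      \<open>1\<close>, \<open>2 * m\<close> and \<open>m\<close> has \<open>m - 1\<close>,
      \<open>2 * m\<close>; they share \<open>2 * m\<close>.\<close>
    have "w \<in> {1, m - 1, 2 * m}"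
      if "w \<in> {0..<int n} - {0, m, m + 1}" "b \<in> {0, m}" "{b, w} \<in> uedges (circ n s)" for b w
      using that adj[of b w] m neg[of 1] neg[of m] 1 by auto
    \<comment> \<open>For \<open>m = 2\<close> the elements \<open>1\<close> and
      \<open>m - 1\<close> of \<open>W\<close> coincide, so \<open>card W\<close> is 3 or 2, in
      either case below 4.\<close>
    then show ?thesis
      using m 1 by (intro not_spanning_cyclable_if_few_neighbours
          [where A = "{0, m, m + 1}" and B = "{0, m}" and W = "{1, m - 1, 2 * m}"])
        (auto simp: verts card_insert_if)
  next
    case 2
    \<comment> \<open>The antipodal vertices \<open>0\<close> and \<open>m + 1\<close> have the same
      four neighbours \<open>1\<close>, \<open>m\<close>, \<open>m + 2\<close>,
      \<open>2 * m + 1\<close>; putting \<open>1\<close> into \<open>A\<close> leaves three.\<close>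
    have "w \<in> {m, m + 2, 2 * m + 1}"
      if "w \<in> {0..<int n} - {0, 1, m + 1}" "b \<in> {0, m + 1}" "{b, w} \<in> uedges (circ n s)" for b w
      using that adj[of b w] m neg[of 1] neg[of m] 2 by auto
    then show ?thesis
      using m 2 by (intro not_spanning_cyclable_if_few_neighbours
          [where A = "{0, 1, m + 1}" and B = "{0, m + 1}" and W = "{m, m + 2, 2 * m + 1}"])
        (auto simp: verts card_insert_if)
  qed
qed

end
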